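(* Let $b\geq 2$ be an integer and let $M\in\mathcal{M}_b(\mathbf{P_1})$. Then $A^{\mathbb{N}}_M$ obeys the following trichotomy: (1) $\dim_H A^{\mathbb{N}}_M>0$; or (2) $A^{\mathbb{N}}_M$ is countably infinite; or (3) $\sharp A^{\mathbb{N}}_M\leq 2^{b-1}$.
   Context: $\mathbb{N}$ is the set of positive integers, $A=\{1,2,\dots,b\}$, and $\sharp$ denotes cardinality. $\mathcal{M}_b$ is the family of nonzero $b\times b$ matrices with entries in $\{0,1\}$; $r_i(M)$ and $c_j(M)$ denote the $i$-th row and $j$-th column of $M$. A matrix $M\in\mathcal{M}_b$ satisfies condition $\mathbf{P_1}$ if $r_i(M)\neq\mathbf{0}$ for every $i\in\{j\in A: c_j(M)\neq\mathbf{0}\}$; $\mathcal{M}_b(\mathbf{P_1})$ is the set of all $M\in\mathcal{M}_b$ satisfying $\mathbf{P_1}$. $A^{\mathbb{N}}$ is the set of infinite words $w=w_1w_2\cdots$ over $A$, equipped with the metric $d(u,v)=0$ if $u=v$ and $d(u,v)=b^{-k(u,v)}$ if $u\neq v$, where $k(u,v)=\min\{k\in\mathbb{N}:u_k\neq v_k\}$. The set of $M$-admissible infinite words is $A^{\mathbb{N}}_M=\{w\in A^{\mathbb{N}}: M_{w_kw_{k+1}}=1\text{ for all }k\in\mathbb{N}\}$. $\dim_H$ denotes Hausdorff dimension with respect to $d$. *)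

theory Defs
  imports "HOL-Analysis.Analysis"
begin

section \<open>Hausdorff measure and dimension in a metric space\<close>

definition ediam :: "'a metric \<Rightarrow> 'a set \<Rightarrow> ennreal" where
  "ediam m U = (SUP x\<in>U. SUP y\<in>U. ennreal (mdist m x y))"

text \<open>The summand \<open>(diam U)\<^sup>s\<close>, for \<open>s \<ge> 0\<close> and \<open>U\<close> of finite diameter. The case distinction is
  needed because \<open>0 powr 0 = 0\<close>: with the usual convention, for \<open>s = 0\<close> every nonempty set counts
  \<open>1\<close> (also a singleton), and the empty set counts \<open>0\<close>.\<close>

definition diam_pow :: "'a metric \<Rightarrow> real \<Rightarrow> 'a set \<Rightarrow> ennreal" where
  "diam_pow m s U =
     (if U = {} then 0 else if s = 0 then 1 else ennreal (enn2real (ediam m U) powr s))"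

text \<open>Finite covers are included, since a sequence of sets may be padded with empty sets.\<close>

definition delta_covers :: "'a metric \<Rightarrow> real \<Rightarrow> 'a set \<Rightarrow> (nat \<Rightarrow> 'a set) set" where
  "delta_covers m \<delta> E =
     {U. E \<subseteq> (\<Union>i. U i) \<and> (\<forall>i. U i \<subseteq> mspace m \<and> ediam m (U i) \<le> ennreal \<delta>)}"

definition hausdorff_pre :: "'a metric \<Rightarrow> real \<Rightarrow> real \<Rightarrow> 'a set \<Rightarrow> ennreal" where
  "hausdorff_pre m s \<delta> E = (INF U\<in>delta_covers m \<delta> E. \<Sum>i. diam_pow m s (U i))"

text \<open>The supremum is the limit as \<open>\<delta>\<close> tends to \<open>0\<close>, as \<open>hausdorff_pre m s \<delta> E\<close> is antitone
  in \<open>\<delta>\<close>.\<close>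

definition hausdorff_measure :: "'a metric \<Rightarrow> real \<Rightarrow> 'a set \<Rightarrow> ennreal" where
  "hausdorff_measure m s E = (SUP \<delta>\<in>{0<..}. hausdorff_pre m s \<delta> E)"

definition hausdorff_dim :: "'a metric \<Rightarrow> 'a set \<Rightarrow> ennreal" where
  "hausdorff_dim m E = (INF s\<in>{s. 0 \<le> s \<and> hausdorff_measure m s E = 0}. ennreal s)"


section \<open>Infinite words\<close>

text \<open>The alphabet with \<open>b\<close> letters is a finite type \<open>'n\<close> with \<open>CARD('n) = b\<close>. An infinite word
  \<open>w\<^sub>1w\<^sub>2\<dots>\<close> is the function \<open>w :: nat \<Rightarrow> 'n\<close> with \<open>w k = w\<^sub>k\<^sub>+\<^sub>1\<close>; the successor in the
  exponent below makes up for the shift of the index.\<close>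

definition word_dist :: "(nat \<Rightarrow> 'n::finite) \<Rightarrow> (nat \<Rightarrow> 'n) \<Rightarrow> real" where
  "word_dist u v =
     (if u = v then 0 else 1 / real CARD('n) ^ Suc (LEAST k. u k \<noteq> v k))"

definition word_metric :: "(nat \<Rightarrow> 'n::finite) metric" where
  "word_metric = metric (UNIV, word_dist)"

lemma word_dist_ultra:
  "word_dist u w \<le> max (word_dist u v) (word_dist v (w :: nat \<Rightarrow> 'n::finite))"
proof (cases "u = v \<or> v = w \<or> u = w")
  case True
  have nonneg: "0 \<le> word_dist x y" for x y :: "nat \<Rightarrow> 'n"
    by (simp add: word_dist_def)
  have zero: "word_dist x x = 0" for x :: "nat \<Rightarrow> 'n"
    by (simp add: word_dist_def)
  show ?thesis
    using True nonneg[of u v] by (elim disjE) (simp_all add: zero max.coboundedI1)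
next
  case False
  define f where "f x y = (LEAST k. x k \<noteq> y k)" for x y :: "nat \<Rightarrow> 'n"
  have eq: "x k = y k" if "k < f x y" for x y :: "nat \<Rightarrow> 'n" and k
    using not_less_Least[of k "\<lambda>k. x k \<noteq> y k"] that by (auto simp: f_def)
  have neq: "x (f x y) \<noteq> y (f x y)" if "x \<noteq> y" for x y :: "nat \<Rightarrow> 'n"
    unfolding f_def using that LeastI_ex[of "\<lambda>k. x k \<noteq> y k"] by blast
  have "\<not> (f u w < f u v \<and> f u w < f v w)"
    using eq[of "f u w" u v] eq[of "f u w" v w] neq[of u w] False by auto
  then have *: "f u v \<le> f u w \<or> f v w \<le> f u w"
    by linarith
  have mono: "1 / real CARD('n) ^ Suc n \<le> 1 / real CARD('n) ^ Suc m" if "m \<le> n" for m n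
  proof (rule divide_left_mono)
    show "real CARD('n) ^ Suc m \<le> real CARD('n) ^ Suc n"
      using that by (intro power_increasing) (auto simp: Suc_le_eq)
  qed auto
  show ?thesis
    using *
  proof
    assume "f u v \<le> f u w"
    then have "word_dist u w \<le> word_dist u v"
      using mono[of "f u v" "f u w"] False by (simp only: word_dist_def f_def if_False de_Morgan_disj)
    then show ?thesis by (rule max.coboundedI1)
  next
    assume "f v w \<le> f u w"
    then have "word_dist u w \<le> word_dist v w"
      using mono[of "f v w" "f u w"] False by (simp only: word_dist_def f_def if_False de_Morgan_disj)
    then show ?thesis by (rule max.coboundedI2)
  qed
qed

lemma Metric_space_word_dist: "Metric_space UNIV (word_dist :: (nat \<Rightarrow> 'n::finite) \<Rightarrow> _)"
proof
  show nonneg: "0 \<le> word_dist u v" for u v :: "nat \<Rightarrow> 'n"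
    by (simp add: word_dist_def)
  show "word_dist u v = word_dist v u" for u v :: "nat \<Rightarrow> 'n"
  proof -
    have "(LEAST k. u k \<noteq> v k) = (LEAST k. v k \<noteq> u k)"
      by (rule arg_cong[of _ _ Least]) auto
    then show ?thesis
      unfolding word_dist_def by (auto simp only: split: if_split)
  qed
  show "word_dist u v = 0 \<longleftrightarrow> u = v" for u v :: "nat \<Rightarrow> 'n"
    by (simp add: word_dist_def)
  show "word_dist u w \<le> word_dist u v + word_dist v w" for u v w :: "nat \<Rightarrow> 'n"
    using word_dist_ultra[of u w v] nonneg[of u v] nonneg[of v w] by linarith
qed

lemma mspace_word_metric [simp]: "mspace word_metric = UNIV"
  and mdist_word_metric [simp]: "mdist word_metric = word_dist"
  unfolding word_metric_def
  using Metric_space.mspace_metric[OF Metric_space_word_dist]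
    Metric_space.mdist_metric[OF Metric_space_word_dist] by auto


section \<open>Matrices and admissible words\<close>

definition zero_one_matrices :: "(nat ^ 'n ^ 'n::finite) set" where
  "zero_one_matrices = {M. M \<noteq> 0 \<and> (\<forall>i j. M $ i $ j \<in> {0, 1})}"

definition P1 :: "nat ^ 'n ^ 'n::finite \<Rightarrow> bool" where
  "P1 M \<longleftrightarrow> (\<forall>i\<in>{j. column j M \<noteq> 0}. row i M \<noteq> 0)"

definition admissible_words :: "nat ^ 'n ^ 'n::finite \<Rightarrow> (nat \<Rightarrow> 'n) set" where
  "admissible_words M = {w. \<forall>k. M $ w k $ w (Suc k) = 1}"

end

theory Submission
  imports Defs
begin

text \<open>View \<open>M\<close> as a directed graph. If there are uncountably many words, then from every vertex
  from which uncountably many words start, two different words stay among such vertices. Cutting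
  these at a uniform length and concatenating them according to the binary digits of
  \<open>x \<in> [0, 1)\<close> gives a map into the admissible words whose inverse is Hoelder continuous, so the
  dimension is positive. If there are finitely many words, remove vertices without predecessors one
  by one: each removal at most halves the total number of words, and at most one word starts
  from each vertex of the set that remains.\<close>

section \<open>Bounds for the Hausdorff dimension\<close>

text \<open>Singletons have diameter 0 and cover \<open>E\<close>, so the measure vanishes for every
  \<open>s > 0\<close>. At \<open>s = 0\<close> each singleton counts 1, so the value 0 is reached
  only as an infimum.\<close>

lemma hausdorff_dim_countable:
  assumes "countable E" and "E \<subseteq> mspace m"
  shows "hausdorff_dim m E = 0"
proof -
  have meas: "hausdorff_measure m s E = 0" if s: "s > 0" for s
  proof -
    have "hausdorff_pre m s \<delta> E = 0" for \<delta>
    proof -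
      define U where "U i = (if E = {} then {} else {from_nat_into E i})" for i
      have ediam0: "ediam m (U i) = 0" for i
      proof (cases "E = {}")
        case False
        then have "from_nat_into E i \<in> mspace m"
          using assms(2) from_nat_into[of E i] by (auto dest: subsetD)
        then show ?thesis by (simp add: U_def False ediam_def)
      qed (simp add: U_def ediam_def bot_ennreal)
      have "U \<in> delta_covers m \<delta> E"
        unfolding delta_covers_def
      proof (intro CollectI conjI allI)
        show "E \<subseteq> (\<Union>i. U i)"
          using from_nat_into_surj[OF assms(1)] by (fastforce simp: U_def)
        show "U i \<subseteq> mspace m" for i
          using assms(2) from_nat_into[of E i] by (auto simp: U_def)
        show "ediam m (U i) \<le> ennreal \<delta>" for i
          by (simp add: ediam0)
      qed
      then have "hausdorff_pre m s \<delta> E \<le> (\<Sum>i. diam_pow m s (U i))"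
        unfolding hausdorff_pre_def by (rule INF_lower)
      moreover have "diam_pow m s (U i) = 0" for i
        using s ediam0[of i] by (simp add: diam_pow_def)
      ultimately show ?thesis by simp
    qed
    then show ?thesis by (simp add: hausdorff_measure_def)
  qed
  have dim_le: "hausdorff_dim m E \<le> ennreal s" if "s > 0" for s
    unfolding hausdorff_dim_def using that meas[OF that] by (intro INF_lower) auto
  have "hausdorff_dim m E \<le> 0"
    by (rule ennreal_le_epsilon) (use dim_le in simp)
  then show ?thesis by simp
qed

text \<open>The mass distribution principle, with Lebesgue measure on \<open>[0, 1)\<close> as the mass: the inverse
  of \<open>f\<close> is Hoelder continuous, so a cover of \<open>E\<close> gives a cover of \<open>[0, 1)\<close> by intervals.\<close>

lemma hausdorff_dim_ge:
  fixes f :: "real \<Rightarrow> 'a"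
  assumes "C > 0" and "s \<ge> 0"
    and f: "\<And>x. x \<in> {0..<1} \<Longrightarrow> f x \<in> E"
    and expand: "\<And>x y. x \<in> {0..<1} \<Longrightarrow> y \<in> {0..<1} \<Longrightarrow> \<bar>x - y\<bar> \<le> C * mdist m (f x) (f y) powr s"
  shows "ennreal s \<le> hausdorff_dim m E"
  unfolding hausdorff_dim_def
proof (rule INF_greatest, clarify)
  fix t :: real
  assume t: "0 \<le> t" "hausdorff_measure m t E = 0"
  have "\<not> t < s"
  proof
    assume ts: "t < s"
    \<comment> \<open>Scale 1 is fine enough: diameters at most 1 give
      \<open>d i powr s \<le> d i powr t\<close> for \<open>t < s\<close>.\<close>
    have "hausdorff_pre m t 1 E \<le> hausdorff_measure m t E"
      unfolding hausdorff_measure_def by (rule SUP_upper) simp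
    \<comment> \<open>The interval \<open>J i\<close> below has length
      \<open>2 * C * d i powr s\<close>, so this threshold forces total length less than 1.\<close>
    then have "hausdorff_pre m t 1 E < ennreal (1 / (2 * C))"
      using t \<open>C > 0\<close> by simp
    then obtain U where U: "U \<in> delta_covers m 1 E"
      and less: "(\<Sum>i. diam_pow m t (U i)) < ennreal (1 / (2 * C))"
      unfolding hausdorff_pre_def INF_less_iff by blast
    define d where "d i = enn2real (ediam m (U i))" for i
    define z where "z i = (SOME x. x \<in> {0..<1} \<and> f x \<in> U i)" for i
    define J where "J i = (if \<exists>x\<in>{0..<1}. f x \<in> U i
      then {z i - C * d i powr s .. z i + C * d i powr s} else {})" for i
    have diam_le: "ediam m (U i) \<le> 1" for i
      using U by (simp add: delta_covers_def)
    have d01: "0 \<le> d i" "d i \<le> 1" for i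
      using enn2real_mono[OF diam_le[of i]] by (simp_all add: d_def)
    have dist_le: "mdist m p q \<le> d i" if "p \<in> U i" "q \<in> U i" for p q i
    proof -
      have "ennreal (mdist m p q) \<le> ediam m (U i)"
        unfolding ediam_def using that by (meson SUP_upper2 order_refl)
      then have "enn2real (ennreal (mdist m p q)) \<le> d i"
        unfolding d_def using diam_le[of i]
        by (intro enn2real_mono) (auto intro: le_less_trans[OF _ ennreal_one_less_top])
      then show ?thesis by simp
    qed
    have cover: "{0..<1} \<subseteq> (\<Union>i. J i)"
    proof
      fix x :: real assume x: "x \<in> {0..<1}"
      then obtain i where i: "f x \<in> U i"
        using U f[OF x] by (auto simp: delta_covers_def)
      then have z: "z i \<in> {0..<1} \<and> f (z i) \<in> U i"
        unfolding z_def using x by (intro someI[of "\<lambda>y. y \<in> {0..<1} \<and> f y \<in> U i" x] conjI)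
      have "\<bar>x - z i\<bar> \<le> C * mdist m (f x) (f (z i)) powr s"
        using expand x z by blast
      also have "\<dots> \<le> C * d i powr s"
        using \<open>C > 0\<close> \<open>s \<ge> 0\<close> dist_le[of "f x" i "f (z i)"] i z
        by (intro mult_left_mono powr_mono2) auto
      finally have "x \<in> J i"
        using x i unfolding J_def by (auto simp: abs_le_iff)
      then show "x \<in> (\<Union>i. J i)" by blast
    qed
    have meas_J: "emeasure lborel (J i) \<le> ennreal (2 * C) * diam_pow m t (U i)" for i
    proof (cases "\<exists>x\<in>{0..<1}. f x \<in> U i")
      case True
      then have ne: "U i \<noteq> {}" by blast
      have "emeasure lborel (J i) = ennreal (2 * C * d i powr s)"
        using True \<open>C > 0\<close> by (simp add: J_def)
      also have "\<dots> = ennreal (2 * C) * ennreal (d i powr s)"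
        using \<open>C > 0\<close> by (simp add: ennreal_mult)
      also have "ennreal (d i powr s) \<le> diam_pow m t (U i)"
      proof (cases "t = 0")
        case True
        have "d i powr s \<le> 1"
          using d01[of i] \<open>s \<ge> 0\<close> by (simp add: powr_le1)
        then show ?thesis using ne True by (simp add: diam_pow_def)
      next
        case False
        have "d i powr s \<le> d i powr t"
          using d01[of i] ts by (intro powr_mono') auto
        then show ?thesis
          using ne False unfolding diam_pow_def d_def by (simp add: ennreal_leI)
      qed
      finally show ?thesis by (simp add: mult_left_mono)
    qed (simp add: J_def)
    have "1 = emeasure lborel {0..<1::real}" by simp
    also have "\<dots> \<le> emeasure lborel (\<Union>i. J i)"
      using cover by (intro emeasure_mono) (auto simp: J_def)
    also have "\<dots> \<le> (\<Sum>i. emeasure lborel (J i))"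
      by (intro emeasure_subadditive_countably) (auto simp: J_def)
    also have "\<dots> \<le> (\<Sum>i. ennreal (2 * C) * diam_pow m t (U i))"
      using meas_J by (intro suminf_le) auto
    also have "\<dots> = ennreal (2 * C) * (\<Sum>i. diam_pow m t (U i))"
      by simp
    also have "\<dots> < ennreal (2 * C) * ennreal (1 / (2 * C))"
      using less \<open>C > 0\<close> by (intro ennreal_mult_strict_left_mono) auto
    also have "\<dots> = 1"
      using \<open>C > 0\<close> by (simp flip: ennreal_mult)
    finally show False by simp
  qed
  then show "ennreal s \<le> ennreal t"
    by (simp add: ennreal_leI)
qed


section \<open>Words with a given first letter\<close>

definition words_from :: "nat ^ 'n ^ 'n::finite \<Rightarrow> 'n \<Rightarrow> (nat \<Rightarrow> 'n) set" where
  "words_from M v = {w \<in> admissible_words M. w 0 = v}"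

lemma admissible_words_eq: "admissible_words M = (\<Union>v. words_from M v)"
  by (auto simp: words_from_def)

lemma case_nat_words_from:
  "w \<in> words_from M u \<Longrightarrow> M $ v $ u = 1 \<Longrightarrow> case_nat v w \<in> words_from M v"
  by (auto simp: words_from_def admissible_words_def split: nat.split)

lemma shift_words_from:
  "w \<in> words_from M v \<Longrightarrow> (\<lambda>i. w (i + k)) \<in> words_from M (w k)"
  by (auto simp: words_from_def admissible_words_def)

lemma words_from_subset: "words_from M v \<subseteq> (\<Union>u\<in>{u. M $ v $ u = 1}. case_nat v ` words_from M u)"
proof
  fix w assume w: "w \<in> words_from M v"
  then have "(\<lambda>i. w (i + 1)) \<in> words_from M (w 1)" "M $ v $ w 1 = 1"
    using shift_words_from[OF w, of 1] by (auto simp: words_from_def admissible_words_def)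
  moreover have "w = case_nat v (\<lambda>i. w (i + 1))"
    using w by (auto simp: words_from_def fun_eq_iff split: nat.split)
  ultimately show "w \<in> (\<Union>u\<in>{u. M $ v $ u = 1}. case_nat v ` words_from M u)"
    by blast
qed

lemma inj_case_nat: "inj (case_nat v :: (nat \<Rightarrow> 'a) \<Rightarrow> _)"
proof (rule injI)
  fix x y :: "nat \<Rightarrow> 'a" assume eq: "case_nat v x = case_nat v y"
  show "x = y"
  proof
    show "x k = y k" for k using fun_cong[OF eq, of "Suc k"] by simp
  qed
qed


section \<open>Finitely many words\<close>

text \<open>If every vertex of \<open>S\<close> has a predecessor, the number of words does not decrease along
  predecessors. Hence from a vertex with the maximal number on, prepending the predecessor is a
  bijection, and so the first \<open>k\<close> letters of a word starting from the \<open>k\<close>-th predecessor are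
  determined; some vertex is the \<open>k\<close>-th predecessor for infinitely many \<open>k\<close>.\<close>

lemma card_words_from_le_1:
  fixes M :: "nat ^ 'n ^ 'n::finite"
  assumes fin: "finite (admissible_words M)"
    and pred: "\<And>v. v \<in> S \<Longrightarrow> \<exists>u\<in>S. M $ u $ v = 1"
    and "v \<in> S"
  shows "card (words_from M v) \<le> 1"
proof -
  define n where "n v = card (words_from M v)" for v
  have fin_from: "finite (words_from M v)" for v
    using fin by (rule rev_finite_subset) (auto simp: words_from_def)
  obtain g where g: "\<And>v. v \<in> S \<Longrightarrow> g v \<in> S \<and> M $ g v $ v = 1"
    using pred by metis
  have sub: "case_nat (g v) ` words_from M v \<subseteq> words_from M (g v)" if "v \<in> S" for v
    using g[OF that] case_nat_words_from by blast
  have card_im: "card (case_nat (g v) ` words_from M v) = n v" for v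
    unfolding n_def by (intro card_image inj_on_subset[OF inj_case_nat]) auto
  have n_le: "n v \<le> n (g v)" if "v \<in> S" for v
    using card_mono[OF fin_from sub[OF that]] by (simp add: card_im n_def)
  have "Max (n ` S) \<in> n ` S"
    using \<open>v \<in> S\<close> by (intro Max_in) auto
  then obtain m where m: "m \<in> S" "n m = Max (n ` S)" by auto
  have max: "n u \<le> n m" if "u \<in> S" for u
    using that m by simp
  define q where "q k = (g ^^ k) m" for k
  have qS: "q k \<in> S" and qm: "n (q k) = n m" for k
  proof (induction k)
    case (Suc k)
    { case 1 show ?case using Suc(1) g by (simp add: q_def) }
    { case 2 show ?case using Suc n_le[of "q k"] max[of "q (Suc k)"] g[of "q k"] by (simp add: q_def) }
  qed (use m in \<open>auto simp: q_def\<close>)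
  have surj: "case_nat (q (Suc k)) ` words_from M (q k) = words_from M (q (Suc k))" for k
  proof (rule card_subset_eq[OF fin_from])
    show "case_nat (q (Suc k)) ` words_from M (q k) \<subseteq> words_from M (q (Suc k))"
      using sub[OF qS[of k]] by (simp add: q_def)
    show "card (case_nat (q (Suc k)) ` words_from M (q k)) = card (words_from M (q (Suc k)))"
      using card_im[of "q k"] qm[of k] qm[of "Suc k"] by (simp add: q_def n_def)
  qed
  have agree: "x i = y i" if "x \<in> words_from M (q k)" "y \<in> words_from M (q k)" "i < k" for x y i k
    using that
  proof (induction k arbitrary: x y i)
    case (Suc k)
    obtain x' y' where "x = case_nat (q (Suc k)) x'" "x' \<in> words_from M (q k)"
      "y = case_nat (q (Suc k)) y'" "y' \<in> words_from M (q k)"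
      using Suc.prems surj[of k] by blast
    with Suc show ?case by (cases i) auto
  qed simp
  obtain k0 where inf: "infinite {k. q k = q k0}"
    using pigeonhole_infinite[of UNIV q] by auto
  have "x = y" if "x \<in> words_from M (q k0)" "y \<in> words_from M (q k0)" for x y
  proof
    fix i
    obtain k where "k > i" "q k = q k0"
      using inf by (auto simp: infinite_nat_iff_unbounded)
    with agree[of x k y i] that show "x i = y i" by simp
  qed
  then have "n (q k0) \<le> 1"
    unfolding n_def using card_le_Suc0_iff_eq[OF fin_from[of "q k0"]] by auto
  then show ?thesis
    using max[OF \<open>v \<in> S\<close>] qm[of k0] by (simp add: n_def)
qed

text \<open>Induction on \<open>card S\<close>. Closure under successors keeps tails in
  \<open>S\<close>. If \<open>v\<close> has no predecessor in \<open>S\<close>, every word from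
  \<open>v\<close> is \<open>v\<close> followed by a word from \<open>S - {v}\<close>, so adding
  \<open>v\<close> at most doubles the sum.\<close>

lemma sum_card_words_from_le:
  fixes M :: "nat ^ 'n ^ 'n::finite"
  assumes fin: "finite (admissible_words M)"
    and "S \<noteq> {}" and "\<And>v u. v \<in> S \<Longrightarrow> M $ v $ u = 1 \<Longrightarrow> u \<in> S"
  shows "(\<Sum>v\<in>S. card (words_from M v)) \<le> 2 ^ (card S - 1)"
  using assms(2,3)
proof (induction "card S" arbitrary: S rule: less_induct)
  case less
  have fin_from: "finite (words_from M v)" for v
    using fin by (rule rev_finite_subset) (auto simp: words_from_def)
  show ?case
  proof (cases "\<forall>v\<in>S. \<exists>u\<in>S. M $ u $ v = 1")
    case True
    then have "(\<Sum>v\<in>S. card (words_from M v)) \<le> (\<Sum>v\<in>S. 1)"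
      by (intro sum_mono card_words_from_le_1[OF fin]) auto
    also have "\<dots> \<le> 2 ^ (card S - 1)"
      \<comment> \<open>This is \<open>n < 2 ^ n\<close> for \<open>n = card S - 1\<close>.\<close>
      using less_exp[of "card S - 1"] by (simp only: card_eq_sum[symmetric])
    finally show ?thesis .
  next
    case False
    then obtain v where v: "v \<in> S" "\<And>u. u \<in> S \<Longrightarrow> M $ u $ v \<noteq> 1" by blast
    define T where "T = S - {v}"
    have card_S: "card S = Suc (card T)"
      using v(1) unfolding T_def by (metis card_Suc_Diff1 finite)
    have "words_from M v \<subseteq> (\<Union>u\<in>T. case_nat v ` words_from M u)"
      using words_from_subset[of M v] less.prems(2)[of v] v unfolding T_def by blast
    then have "card (words_from M v) \<le> card (\<Union>u\<in>T. case_nat v ` words_from M u)"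
      using fin_from by (intro card_mono) auto
    also have "\<dots> \<le> (\<Sum>u\<in>T. card (case_nat v ` words_from M u))"
      by (rule card_UN_le) simp
    also have "\<dots> \<le> (\<Sum>u\<in>T. card (words_from M u))"
      by (intro sum_mono card_image_le fin_from)
    finally have "(\<Sum>u\<in>S. card (words_from M u)) \<le> 2 * (\<Sum>u\<in>T. card (words_from M u))"
      using v(1) by (simp add: T_def sum.remove[of S v])
    also have "\<dots> \<le> 2 ^ card T"
    \<comment> \<open>With truncated subtraction \<open>2 * 2 ^ (card T - 1)\<close> exceeds
      \<open>2 ^ card T\<close> for empty \<open>T\<close>; there the sum itself is 0.\<close>
    proof (cases "T = {}")
      case False
      \<comment> \<open>Closure survives the removal because \<open>v\<close> is not a successor of
        any vertex of \<open>S\<close>.\<close>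
      have "u \<in> T" if "w \<in> T" "M $ w $ u = 1" for w u
        using that less.prems(2)[of w u] v by (auto simp: T_def)
      then have "(\<Sum>u\<in>T. card (words_from M u)) \<le> 2 ^ (card T - 1)"
        using False card_S by (intro less.hyps) auto
      moreover have "card T > 0"
        using False by (simp add: card_gt_0_iff)
      ultimately show ?thesis
        by (cases "card T") auto
    qed simp
    finally show ?thesis by (simp add: card_S)
  qed
qed

lemma card_admissible_words_le:
  fixes M :: "nat ^ 'n ^ 'n::finite"
  assumes "finite (admissible_words M)"
  shows "card (admissible_words M) \<le> 2 ^ (CARD('n) - 1)"
proof -
  have "card (admissible_words M) \<le> (\<Sum>v\<in>UNIV. card (words_from M v))"
    unfolding admissible_words_eq by (rule card_UN_le) simp
  also have "\<dots> \<le> 2 ^ (CARD('n) - 1)"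
    using assms by (intro sum_card_words_from_le) auto
  finally show ?thesis .
qed


section \<open>Uncountably many words\<close>

definition rich :: "nat ^ 'n ^ 'n::finite \<Rightarrow> 'n set" where
  "rich M = {v. uncountable (words_from M v)}"

text \<open>A word is determined by its first \<open>k\<close> letters and its tail from position
  \<open>k\<close>. The prefixes are countably many, and so are the tails that start outside
  \<open>rich M\<close>.\<close>

lemma countable_leaving_rich:
  fixes M :: "nat ^ 'n ^ 'n::finite"
  shows "countable {w \<in> admissible_words M. w k \<notin> rich M}"
proof -
  let ?X = "{w \<in> admissible_words M. w k \<notin> rich M}"
  let ?f = "\<lambda>w::nat \<Rightarrow> 'n. (map w [0..<k], \<lambda>i. w (i + k))"
  have "inj ?f"
  proof (rule injI)
    fix x y assume eq: "?f x = ?f y"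
    show "x = y"
    proof
      fix i
      show "x i = y i"
      proof (cases "i < k")
        case False
        then show ?thesis
          using eq fun_cong[of "\<lambda>i. x (i + k)" "\<lambda>i. y (i + k)" "i - k"] by simp
      qed (use eq in auto)
    qed
  qed
  moreover have "?f ` ?X \<subseteq> UNIV \<times> (\<Union>u\<in>- rich M. words_from M u)"
    using shift_words_from by (fastforce simp: admissible_words_eq)
  moreover have "countable ((UNIV :: 'n list set) \<times> (\<Union>u\<in>- rich M. words_from M u))"
    by (intro countable_SIGMA countable_UN) (auto simp: rich_def)
  ultimately show ?thesis
    by (meson countable_image_inj_on countable_subset inj_on_subset subset_UNIV)
qed

text \<open>Only countably many words ever leave \<open>rich M\<close>. If at most one word from
  \<open>v\<close> stayed inside, \<open>words_from M v\<close> would be countable.\<close>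

lemma two_rich_words:
  fixes M :: "nat ^ 'n ^ 'n::finite"
  assumes "v \<in> rich M"
  shows "\<exists>x\<in>words_from M v. \<exists>y\<in>words_from M v. range x \<subseteq> rich M \<and> range y \<subseteq> rich M \<and> x \<noteq> y"
proof (rule ccontr)
  define Y where "Y = {w \<in> words_from M v. range w \<subseteq> rich M}"
  assume "\<not> ?thesis"
  then have "\<forall>x\<in>Y. \<forall>y\<in>Y. x = y"
    unfolding Y_def by blast
  then have "countable Y"
    by (intro countableI'[of "\<lambda>_. 0"] inj_onI) blast
  then have "countable (Y \<union> (\<Union>k. {w \<in> admissible_words M. w k \<notin> rich M}))"
    using countable_leaving_rich[of M] by (intro countable_Un countable_UN) auto
  moreover have "words_from M v \<subseteq> Y \<union> (\<Union>k. {w \<in> admissible_words M. w k \<notin> rich M})"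
    by (auto simp: Y_def words_from_def)
  ultimately have "countable (words_from M v)"
    using countable_subset by blast
  then show False
    using assms by (simp add: rich_def)
qed

section \<open>Concatenation of blocks chosen by binary digits\<close>

primrec block_state :: "('a \<Rightarrow> bool \<Rightarrow> nat \<Rightarrow> 'a) \<Rightarrow> nat \<Rightarrow> 'a \<Rightarrow> (nat \<Rightarrow> bool) \<Rightarrow> nat \<Rightarrow> 'a" where
  "block_state P L v e 0 = v"
| "block_state P L v e (Suc n) = P (block_state P L v e n) (e n) L"

text \<open>The word \<open>P v (e 0)\<close> is followed for \<open>L\<close> steps, then \<open>P u (e 1)\<close> with \<open>u\<close> the letter
  reached, and so on.\<close>

definition block_word :: "('a \<Rightarrow> bool \<Rightarrow> nat \<Rightarrow> 'a) \<Rightarrow> nat \<Rightarrow> 'a \<Rightarrow> (nat \<Rightarrow> bool) \<Rightarrow> nat \<Rightarrow> 'a" where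
  "block_word P L v e k = P (block_state P L v e (k div L)) (e (k div L)) (k mod L)"

lemma block_state_cong:
  "(\<And>i. i < n \<Longrightarrow> e i = e' i) \<Longrightarrow> block_state P L v e n = block_state P L v e' n"
  by (induction n) auto

lemma block_state_in:
  "v \<in> U \<Longrightarrow> (\<And>u b k. u \<in> U \<Longrightarrow> P u b k \<in> U) \<Longrightarrow> block_state P L v e n \<in> U"
  by (induction n) auto

text \<open>The case \<open>j = L\<close> matters: a block's end letter is the first letter of the
  next block, as \<open>P u b 0 = u\<close>. So transitions across block boundaries need no separate
  treatment.\<close>

lemma block_word_eq:
  assumes "v \<in> U" and P: "\<And>u b k. u \<in> U \<Longrightarrow> P u b k \<in> U" "\<And>u b. u \<in> U \<Longrightarrow> P u b 0 = u"
    and "L > 0" and "j \<le> L"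
  shows "block_word P L v e (n * L + j) = P (block_state P L v e n) (e n) j"
proof (cases "j < L")
  case True
  then show ?thesis by (simp add: block_word_def)
next
  case False
  then have j: "n * L + j = Suc n * L" using assms by simp
  have "P (block_state P L v e (Suc n)) (e (Suc n)) 0 = block_state P L v e (Suc n)"
    using block_state_in[of v U P L e "Suc n"] assms by blast
  then show ?thesis
    using False assms unfolding j block_word_def by (simp del: mult_Suc)
qed

definition binary_digit :: "real \<Rightarrow> nat \<Rightarrow> bool" where
  "binary_digit x n \<longleftrightarrow> odd \<lfloor>x * 2 ^ Suc n\<rfloor>"

text \<open>Since \<open>\<lfloor>x * 2 ^ Suc k\<rfloor>\<close> is twice
  \<open>\<lfloor>x * 2 ^ k\<rfloor>\<close> plus digit \<open>k\<close>, equal digits below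
  \<open>n\<close> give equal floors of \<open>x * 2 ^ n\<close> and
  \<open>y * 2 ^ n\<close>.\<close>

lemma abs_diff_less_of_binary_digits_eq:
  assumes x: "x \<in> {0..<1}" and y: "y \<in> {0..<1}"
    and eq: "\<And>i. i < n \<Longrightarrow> binary_digit x i = binary_digit y i"
  shows "\<bar>x - y\<bar> < 1 / 2 ^ n"
proof -
  have half: "\<lfloor>z * 2 ^ Suc k\<rfloor> div 2 = \<lfloor>z * 2 ^ k\<rfloor>" for z :: real and k
    using floor_divide_real_eq_div[of 2 "z * 2 ^ Suc k"] by simp
  have "\<lfloor>x * 2 ^ n\<rfloor> = \<lfloor>y * 2 ^ n\<rfloor>"
    using eq
  proof (induction n)
    case 0
    have "\<lfloor>z\<rfloor> = 0" if "z \<in> {0..<1}" for z :: real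
      using that by (simp add: floor_eq_iff)
    then show ?case using x y by simp
  next
    case (Suc n)
    have "\<lfloor>x * 2 ^ Suc n\<rfloor> div 2 = \<lfloor>y * 2 ^ Suc n\<rfloor> div 2"
      unfolding half using Suc.prems by (intro Suc.IH) simp
    moreover have "\<lfloor>x * 2 ^ Suc n\<rfloor> mod 2 = \<lfloor>y * 2 ^ Suc n\<rfloor> mod 2"
      using Suc.prems[of n] by (simp only: binary_digit_def even_iff_mod_2_eq_zero odd_iff_mod_2_eq_one) presburger
    ultimately show ?case
      by (metis div_mult_mod_eq)
  qed
  then have "\<bar>x * 2 ^ n - y * 2 ^ n\<bar> < 1"
    by linarith
  then have "\<bar>x - y\<bar> * 2 ^ n < 1"
    by (simp add: abs_mult flip: left_diff_distrib)
  then show ?thesis by (simp add: field_simps)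
qed

lemma word_dist_ge:
  fixes x y :: "nat \<Rightarrow> 'n::finite"
  assumes "x k \<noteq> y k" and "k \<le> N"
  shows "word_dist x y \<ge> 1 / real CARD('n) ^ Suc N"
proof -
  have "(LEAST k. x k \<noteq> y k) \<le> N"
    using Least_le[of "\<lambda>k. x k \<noteq> y k", OF assms(1)] assms(2) by simp
  then have "real CARD('n) ^ Suc (LEAST k. x k \<noteq> y k) \<le> real CARD('n) ^ Suc N"
    by (intro power_increasing) (auto simp: Suc_le_eq)
  moreover have "x \<noteq> y" using assms(1) by auto
  ultimately show ?thesis
    unfolding word_dist_def by (simp only: if_False) (intro divide_left_mono, auto)
qed

lemma hausdorff_dim_pos:
  fixes M :: "nat ^ 'n ^ 'n::finite"
  assumes card: "CARD('n) \<ge> 2" and unc: "uncountable (admissible_words M)"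
  shows "hausdorff_dim word_metric (admissible_words M) > 0"
proof -
  let ?U = "rich M"
  let ?b = "real CARD('n)"
  obtain X Y where XY: "\<And>v. v \<in> ?U \<Longrightarrow> X v \<in> words_from M v \<and> Y v \<in> words_from M v \<and>
      range (X v) \<subseteq> ?U \<and> range (Y v) \<subseteq> ?U \<and> X v \<noteq> Y v"
    using two_rich_words[of _ M] unfolding Bex_def by metis
  define P where "P v b = (if b then X v else Y v)" for v b
  have P_from: "P v b \<in> words_from M v" and P_in: "P v b k \<in> ?U" and P_neq: "P v True \<noteq> P v False"
    if "v \<in> ?U" for v b k
    using XY[OF that] by (auto simp: P_def)
  have P_0: "P v b 0 = v" and P_step: "M $ P v b k $ P v b (Suc k) = 1" if "v \<in> ?U" for v b k
    using P_from[OF that] by (auto simp: words_from_def admissible_words_def)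
  have "\<exists>k. P v True k \<noteq> P v False k" if "v \<in> ?U" for v
    using P_neq[OF that] by (simp add: fun_eq_iff)
  then obtain K where K: "\<And>v. v \<in> ?U \<Longrightarrow> P v True (K v) \<noteq> P v False (K v)"
    by metis
  \<comment> \<open>The alphabet is finite, so one block length exceeds all \<open>K v\<close>: the
    two choices at any rich letter differ within a block.\<close>
  define L where "L = Suc (Max (range K))"
  have KL: "K v \<le> L" for v
    unfolding L_def by (intro le_SucI Max_ge) auto
  have "L > 0" by (simp add: L_def)
  obtain v where v: "v \<in> ?U"
    using unc by (auto simp: admissible_words_eq rich_def)
  define f where "f x = block_word P L v (binary_digit x)" for x
  have f_eq: "f x (n * L + j) = P (block_state P L v (binary_digit x) n) (binary_digit x n) j"
    if "j \<le> L" for x n j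
    unfolding f_def using block_word_eq[of v ?U P L j] v P_in P_0 \<open>L > 0\<close> that by blast
  have state_in: "block_state P L v e n \<in> ?U" for e n
    using block_state_in[of v ?U P] v P_in by blast
  have f_adm: "f x \<in> admissible_words M" for x
    unfolding admissible_words_def
  proof (intro CollectI allI)
    fix k
    have "k mod L < L" using \<open>L > 0\<close> by simp
    then have "f x k = P (block_state P L v (binary_digit x) (k div L)) (binary_digit x (k div L)) (k mod L)"
      "f x (Suc k) = P (block_state P L v (binary_digit x) (k div L)) (binary_digit x (k div L)) (Suc (k mod L))"
      using f_eq[of "k mod L" x "k div L"] f_eq[of "Suc (k mod L)" x "k div L"]
      by (simp_all only: less_imp_le_nat Suc_leI add_Suc_right div_mult_mod_eq)
    then show "M $ f x k $ f x (Suc k) = 1"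
      using P_step state_in by simp
  qed
  \<comment> \<open>Chosen so that \<open>?b powr (L * s) = 2\<close>: one block of \<open>L\<close>
    letters scales like one binary digit.\<close>
  define s where "s = ln 2 / (real L * ln ?b)"
  have ln_b: "ln ?b > 0" using card by simp
  have s: "s > 0" using ln_b \<open>L > 0\<close> by (simp add: s_def)
  have "\<bar>x - y\<bar> \<le> 4 * mdist word_metric (f x) (f y) powr s" if x: "x \<in> {0..<1}" and y: "y \<in> {0..<1}" for x y
  proof (cases "x = y")
    case False
    have "\<exists>n. binary_digit x n \<noteq> binary_digit y n"
    proof (rule ccontr)
      assume "\<not> ?thesis"
      then have "\<bar>x - y\<bar> < 1 / 2 ^ n" for n
        using abs_diff_less_of_binary_digits_eq[OF x y] by blast
      moreover obtain n where "(1 / 2) ^ n < \<bar>x - y\<bar>"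
        using False real_arch_pow_inv[of "\<bar>x - y\<bar>" "1 / 2"] by auto
      ultimately show False by (metis less_asym power_one_over)
    qed
    then obtain n where n: "binary_digit x n \<noteq> binary_digit y n"
      and below: "\<And>i. i < n \<Longrightarrow> binary_digit x i = binary_digit y i"
      using exists_least_iff[of "\<lambda>n. binary_digit x n \<noteq> binary_digit y n"] by blast
    \<comment> \<open>Up to the first differing digit both words coincide, so block \<open>n\<close>
      starts at the same letter \<open>u\<close> in both, and they differ at offset
      \<open>K u\<close>.\<close>
    define u where "u = block_state P L v (binary_digit x) n"
    have u: "u \<in> ?U" "block_state P L v (binary_digit y) n = u"
      using state_in block_state_cong[of n "binary_digit x" "binary_digit y" P L v] below
      by (auto simp: u_def)
    have "f x (n * L + K u) \<noteq> f y (n * L + K u)"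
      unfolding f_eq[OF KL] u(2) u_def[symmetric] using n K[OF u(1)]
      by (cases "binary_digit x n"; cases "binary_digit y n") auto
    then have "1 / ?b ^ Suc (n * L + L) \<le> word_dist (f x) (f y)"
      using KL[of u] by (intro word_dist_ge) auto
    then have dist: "(1 / ?b ^ Suc (n * L + L)) powr s \<le> word_dist (f x) (f y) powr s"
      using s by (intro powr_mono2) auto
    \<comment> \<open>The exponent \<open>Suc (n * L + L) / L = n + 1 + 1 / L\<close> is at most
      \<open>n + 2\<close>; this is the origin of the constant 4.\<close>
    have "1 / 2 ^ n = 4 * 2 powr (- real (n + 2))"
      unfolding powr_minus by (subst powr_realpow) (auto simp: inverse_eq_divide)
    also have "\<dots> \<le> 4 * 2 powr (- (real (Suc (n * L + L)) / real L))"
      using \<open>L > 0\<close> by (simp add: field_simps)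
    also have "2 powr (- (real (Suc (n * L + L)) / real L)) = (1 / ?b ^ Suc (n * L + L)) powr s"
      using ln_b by (simp add: powr_def s_def ln_div ln_realpow del: power_Suc)
    also note dist
    finally have "1 / 2 ^ n \<le> 4 * word_dist (f x) (f y) powr s" by simp
    moreover have "\<bar>x - y\<bar> < 1 / 2 ^ n"
      using abs_diff_less_of_binary_digits_eq[OF x y] below by blast
    ultimately show ?thesis by simp
  qed simp
  then have "ennreal s \<le> hausdorff_dim word_metric (admissible_words M)"
    using s f_adm by (intro hausdorff_dim_ge[of 4 s f]) auto
  moreover have "ennreal s > 0" using s by simp
  ultimately show ?thesis by (rule less_le_trans[rotated])
qed

theorem corollary1:
  fixes M :: "nat ^ 'n ^ 'n::finite"
  assumes "CARD('n) \<ge> 2"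
    and "M \<in> zero_one_matrices"
    and "P1 M"
  shows "let W = admissible_words M;
             positive_dim = (hausdorff_dim word_metric W > 0);
             countably_infinite = (countable W \<and> infinite W);
             small = (finite W \<and> card W \<le> 2 ^ (CARD('n) - 1))
         in (positive_dim \<or> countably_infinite \<or> small) \<and>
            \<not> (positive_dim \<and> countably_infinite) \<and>
            \<not> (positive_dim \<and> small) \<and>
            \<not> (countably_infinite \<and> small)"
proof -
  \<comment> \<open>Dimension 0 for countable sets makes the first alternative exclude the other
    two.\<close>
  have "hausdorff_dim word_metric (admissible_words M) = 0" if "countable (admissible_words M)"
    using hausdorff_dim_countable[OF that] by simp
  then show ?thesis
    using card_admissible_words_le[of M] hausdorff_dim_pos[OF assms(1), of M] countable_finite[of "admissible_words M"]
    unfolding Let_def by auto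
qed

end
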